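(* Let $F\in H^{2}(0,\pi)$ be real-valued with $F(x)>0$ for all $x\in[0,\pi]$, and set $a(x)=\sqrt{F(x)}$, $q(x)=a''(x)/a(x)$, $h=a'(0)/a(0)$. Let $\{\mu_k^{2}\}_{k=0}^{\infty}$ be the spectrum of the Sturm–Liouville problem $-y''+q(x)y=\rho^{2}y$ on $(0,\pi)$, $y'(0)-hy(0)=0$, $y(\pi)=0$. Let $\varphi$, $S$, $T$ be the solutions and $\{g_n\}$, $\{t_n\}$ the coefficient functions defined in the context. Then for each $k\ge 0$ there is a constant $\beta_k\neq 0$ such that $T(\mu_k,x)=\beta_k\varphi(\mu_k,x)$ for all $x\in[0,\pi]$, this constant is given by $$\beta_k=-S(\mu_k,\pi),$$ and for all $x\in[0,\pi]$ and all $k\ge 0$ the coefficients satisfy the linear equations $$\sum_{n=0}^{\infty}(-1)^{n}g_{n}(x)j_{2n}(\mu_{k}x)-\frac{1}{\beta_{k}\mu_{k}}\sum_{n=0}^{\infty}(-1)^{n}t_{n}(x)j_{2n+1}\bigl(\mu_{k}(x-\pi)\bigr)=-\cos\mu_{k}x+\frac{\sin\bigl(\mu_{k}(x-\pi)\bigr)}{\beta_{k}\mu_{k}}.$$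
   Context: Primes denote derivatives with respect to $x$, and $j_k$ denotes the spherical Bessel function of the first kind of order $k$. For $\rho\in\mathbb{C}$, $\varphi(\rho,x)$, $S(\rho,x)$ and $T(\rho,x)$ are the solutions of $-y''+q(x)y=\rho^{2}y$ on $(0,\pi)$ with $\varphi(\rho,0)=1$, $\varphi'(\rho,0)=h$; $S(\rho,0)=0$, $S'(\rho,0)=1$; $T(\rho,\pi)=0$, $T'(\rho,\pi)=1$. It is a known fact that, for real-valued $q\in L_2(0,\pi)$ and real $h$, there are functions $g_n(x)$, $t_n(x)$, independent of $\rho$, such that $$\varphi(\rho,x)=\cos\rho x+\sum_{n=0}^{\infty}(-1)^{n}g_{n}(x)j_{2n}(\rho x),$$ $$T(\rho,x)=\frac{\sin(\rho(x-\pi))}{\rho}+\frac{1}{\rho}\sum_{n=0}^{\infty}(-1)^{n}t_{n}(x)j_{2n+1}(\rho(x-\pi)),$$ where the series converge pointwise for every $\rho\in\mathbb{C}$ and, for every $x\in[0,\pi]$, uniformly in $\rho$ on compact subsets of $\mathbb{C}$ (the expression for $T$ at $\rho=0$ being understood as a limit). Here $\mu_k$ denotes a square root of the eigenvalue $\mu_k^2$; zero is not an eigenvalue of the stated problem, so $\mu_k\neq 0$. *)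

theory Defs
  imports "HOL-Analysis.Analysis"
begin

definition abs_continuous_on :: "real set \<Rightarrow> (real \<Rightarrow> 'a::real_normed_vector) \<Rightarrow> bool" where
  "abs_continuous_on S f \<longleftrightarrow>
     (\<forall>\<epsilon>>0. \<exists>\<delta>>0. \<forall>P :: (real \<times> real) set.
        finite P \<and> (\<forall>(u, v)\<in>P. u \<le> v \<and> {u..v} \<subseteq> S) \<and>
        disjoint_family_on (\<lambda>(u, v). {u<..<v}) P \<and> (\<Sum>(u, v)\<in>P. v - u) < \<delta>
        \<longrightarrow> (\<Sum>(u, v)\<in>P. norm (f v - f u)) < \<epsilon>)"

text \<open>Derivative relative to the interval, hence one-sided at its endpoints.\<close>

definition D_on :: "real set \<Rightarrow> (real \<Rightarrow> 'a::real_normed_vector) \<Rightarrow> real \<Rightarrow> 'a" where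
  "D_on S f x = vector_derivative f (at x within S)"

text \<open>The Sobolev space \<open>H\<^sup>2(a,b)\<close> of real-valued functions, in terms of the continuously
  differentiable representative: \<open>f\<close> is differentiable on \<open>[a,b]\<close>, \<open>f'\<close> is absolutely
  continuous, and \<open>f''\<close>, which exists almost everywhere, is square integrable.\<close>

definition H2 :: "real \<Rightarrow> real \<Rightarrow> (real \<Rightarrow> real) \<Rightarrow> bool" where
  "H2 a b f \<longleftrightarrow>
     (\<forall>x\<in>{a..b}. f differentiable (at x within {a..b})) \<and>
     abs_continuous_on {a..b} (D_on {a..b} f) \<and>
     (\<exists>g. g \<in> borel_measurable (lebesgue_on {a..b}) \<and>
          set_integrable lebesgue {a..b} (\<lambda>x. (g x)\<^sup>2) \<and>
          (AE x\<in>{a<..<b} in lebesgue. (D_on {a..b} f has_vector_derivative g x) (at x)))"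

text \<open>Solutions of \<open>-y'' + q y = \<lambda> y\<close> on \<open>(a,b)\<close>. As \<open>q\<close> is merely integrable,
  \<open>y'\<close> is absolutely continuous on \<open>[a,b]\<close> and the equation holds almost everywhere.\<close>

definition sl_solution ::
  "real \<Rightarrow> real \<Rightarrow> (real \<Rightarrow> real) \<Rightarrow> complex \<Rightarrow> (real \<Rightarrow> complex) \<Rightarrow> bool" where
  "sl_solution a b q lam y \<longleftrightarrow>
     (\<forall>x\<in>{a..b}. y differentiable (at x within {a..b})) \<and>
     abs_continuous_on {a..b} (D_on {a..b} y) \<and>
     (AE x\<in>{a<..<b} in lebesgue.
        \<exists>y2. (D_on {a..b} y has_vector_derivative y2) (at x) \<and>
             - y2 + complex_of_real (q x) * y x = lam * y x)"

definition sl_spectrum :: "(real \<Rightarrow> real) \<Rightarrow> real \<Rightarrow> complex set" where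
  "sl_spectrum q h =
     {lam. \<exists>y. sl_solution 0 pi q lam y \<and>
               D_on {0..pi} y 0 - complex_of_real h * y 0 = 0 \<and> y pi = 0 \<and>
               (\<exists>x\<in>{0..pi}. y x \<noteq> 0)}"

text \<open>Power series of \<open>j\<^sub>k(z) = \<surd>(\<pi>/(2z)) J\<^bsub>k+1/2\<^esub>(z)\<close> (DLMF 10.53.1), which
  defines it as an entire function; the product is the double factorial \<open>(2k+2m+1)!!\<close>.\<close>

definition sph_bessel_j :: "nat \<Rightarrow> complex \<Rightarrow> complex" where
  "sph_bessel_j k z =
     z ^ k * (\<Sum>m. (- (z\<^sup>2) / 2) ^ m / (fact m * (\<Prod>i\<le>k + m. of_nat (2 * i + 1))))"

definition phi_term :: "(nat \<Rightarrow> real \<Rightarrow> complex) \<Rightarrow> complex \<Rightarrow> real \<Rightarrow> nat \<Rightarrow> complex" where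
  "phi_term g \<rho> x n = (- 1) ^ n * g n x * sph_bessel_j (2 * n) (\<rho> * of_real x)"

definition T_term :: "(nat \<Rightarrow> real \<Rightarrow> complex) \<Rightarrow> complex \<Rightarrow> real \<Rightarrow> nat \<Rightarrow> complex" where
  "T_term t \<rho> x n = (- 1) ^ n * t n x * sph_bessel_j (2 * n + 1) (\<rho> * of_real (x - pi))"

definition phi_coefficients ::
  "(complex \<Rightarrow> real \<Rightarrow> complex) \<Rightarrow> (nat \<Rightarrow> real \<Rightarrow> complex) \<Rightarrow> bool" where
  "phi_coefficients \<phi> g \<longleftrightarrow>
     (\<forall>x\<in>{0..pi}.
        (\<forall>\<rho>. summable (phi_term g \<rho> x) \<and>
             \<phi> \<rho> x = cos (\<rho> * of_real x) + (\<Sum>n. phi_term g \<rho> x n)) \<and>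
        (\<forall>K. compact K \<longrightarrow>
             uniform_limit K (\<lambda>N \<rho>. \<Sum>n<N. phi_term g \<rho> x n)
               (\<lambda>\<rho>. \<Sum>n. phi_term g \<rho> x n) sequentially))"

text \<open>The factor \<open>1/\<rho>\<close> has a removable singularity at \<open>0\<close>: the value at \<open>\<rho> = 0\<close> is given
  by the limit, and uniform convergence on a compact set is stated off the origin.\<close>

definition T_coefficients ::
  "(complex \<Rightarrow> real \<Rightarrow> complex) \<Rightarrow> (nat \<Rightarrow> real \<Rightarrow> complex) \<Rightarrow> bool" where
  "T_coefficients T t \<longleftrightarrow>
     (\<forall>x\<in>{0..pi}.
        (\<forall>\<rho>. \<rho> \<noteq> 0 \<longrightarrow>
             summable (T_term t \<rho> x) \<and>
             T \<rho> x = sin (\<rho> * of_real (x - pi)) / \<rho> + 1 / \<rho> * (\<Sum>n. T_term t \<rho> x n)) \<and>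
        ((\<lambda>\<rho>. sin (\<rho> * of_real (x - pi)) / \<rho> + 1 / \<rho> * (\<Sum>n. T_term t \<rho> x n))
           \<longlongrightarrow> T 0 x) (at 0) \<and>
        (\<forall>K. compact K \<longrightarrow>
             uniform_limit (K - {0}) (\<lambda>N \<rho>. 1 / \<rho> * (\<Sum>n<N. T_term t \<rho> x n))
               (\<lambda>\<rho>. 1 / \<rho> * (\<Sum>n. T_term t \<rho> x n)) sequentially))"

end

theory Submission
  imports Defs
begin

text \<open>The proof rests on the Wronskian \<open>W(u, v) = u v' - u' v\<close>, which is constant for any two
  solutions with the same spectral parameter. By their initial values, \<open>\<phi>\<close> and \<open>S\<close> have
  Wronskian \<open>1\<close>, so every solution \<open>y\<close> is \<open>W(y, S) \<phi> + W(\<phi>, y) S\<close>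
  (\<open>sl_solution_decomposition\<close>).

  At \<open>\<rho> = \<mu>\<^sub>k\<close> an eigenfunction has the same initial ratio \<open>y'/y\<close> as \<open>\<phi>\<close>, hence is a multiple of
  \<open>\<phi>\<close>, and therefore \<open>\<phi>(\<pi>) = 0\<close>. Now \<open>1 = W(\<phi>, S)(\<pi>) = - \<phi>'(\<pi>) S(\<pi>)\<close> shows \<open>S(\<pi>) \<noteq> 0\<close>, and
  evaluating the coefficients of \<open>T\<close> at \<open>\<pi>\<close> gives \<open>W(\<phi>, T) = 0\<close> and \<open>W(T, S) = - S(\<pi>)\<close>, so that
  \<open>T = - S(\<pi>) \<phi>\<close>. Substituting the two series into \<open>\<phi> = T / \<beta>\<^sub>k\<close> yields the linear equations.

  The series of \<open>T\<close> may be used at \<open>\<rho> = \<mu>\<^sub>k\<close> only if \<open>\<mu>\<^sub>k \<noteq> 0\<close>. This holds because the positive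
  function \<open>a = \<surd>F\<close> solves the equation at \<open>\<rho> = 0\<close> and satisfies the boundary condition at \<open>0\<close>
  (\<open>sl_solution_of_H2_sqrt\<close>), so it is a multiple of \<open>\<phi>\<close> at \<open>\<rho> = 0\<close>, which therefore
  cannot vanish at \<open>\<pi>\<close>.

  Since solutions satisfy the equation only almost everywhere, the constancy of the Wronskian
  requires the theorem that an absolutely continuous function with derivative zero almost
  everywhere is constant; it is proved in the first part.\<close>

section \<open>Absolutely continuous functions\<close>

lemma abs_continuous_on_subset:
  assumes "abs_continuous_on S f" "R \<subseteq> S"
  shows "abs_continuous_on R f"
proof -
  have mono: "\<forall>(u, v)\<in>P. u \<le> v \<and> {u..v} \<subseteq> S"
    if "\<forall>(u, v)\<in>P. u \<le> v \<and> {u..v} \<subseteq> R" for P :: "(real \<times> real) set"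
    using that assms(2) by blast
  show ?thesis
    using assms(1) mono unfolding abs_continuous_on_def by meson
qed

lemma abs_continuous_on_ident: "abs_continuous_on S (\<lambda>x. x)"
  unfolding abs_continuous_on_def
proof (intro allI impI)
  fix \<epsilon> :: real assume "\<epsilon> > 0"
  have "(\<Sum>(u, v)\<in>P. norm (v - u)) = (\<Sum>(u, v)\<in>P. v - u)" 
    if "\<forall>(u, v)\<in>P. u \<le> v \<and> {u..v} \<subseteq> S" for P :: "(real \<times> real) set"
    using that by (intro sum.cong) auto
  with \<open>\<epsilon> > 0\<close> show "\<exists>\<delta>>0. \<forall>P :: (real \<times> real) set.
        finite P \<and> (\<forall>(u, v)\<in>P. u \<le> v \<and> {u..v} \<subseteq> S) \<and>
        disjoint_family_on (\<lambda>(u, v). {u<..<v}) P \<and> (\<Sum>(u, v)\<in>P. v - u) < \<delta>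
        \<longrightarrow> (\<Sum>(u, v)\<in>P. norm (v - u)) < \<epsilon>"
    by (intro exI[of _ \<epsilon>]) simp
qed

text \<open>The common source of the closure properties: it is enough to control the increments of a
  function by those of absolutely continuous ones.\<close>

lemma abs_continuous_on_dominated:
  assumes f: "abs_continuous_on S f" and g: "abs_continuous_on S g"
    and dom: "\<And>u v. u \<in> S \<Longrightarrow> v \<in> S \<Longrightarrow> norm (H v - H u) \<le> M * (norm (f v - f u) + norm (g v - g u))"
  shows "abs_continuous_on S H"
  unfolding abs_continuous_on_def
proof (intro allI impI)
  fix \<epsilon> :: real assume "\<epsilon> > 0"
  define m where "m = \<bar>M\<bar> + 1"
  have m: "m > 0" "M \<le> m" by (auto simp: m_def)
  define e where "e = \<epsilon> / (2 * m)"
  have e: "e > 0" using \<open>\<epsilon> > 0\<close> m by (simp add: e_def)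
  obtain d1 where d1: "d1 > 0" "\<And>P. finite P \<Longrightarrow> (\<forall>(u, v)\<in>P. u \<le> v \<and> {u..v} \<subseteq> S) \<Longrightarrow>
      disjoint_family_on (\<lambda>(u, v). {u<..<v}) P \<Longrightarrow> (\<Sum>(u, v)\<in>P. v - u) < d1 \<Longrightarrow>
      (\<Sum>(u, v)\<in>P. norm (f v - f u)) < e"
    using f e unfolding abs_continuous_on_def by meson
  obtain d2 where d2: "d2 > 0" "\<And>P. finite P \<Longrightarrow> (\<forall>(u, v)\<in>P. u \<le> v \<and> {u..v} \<subseteq> S) \<Longrightarrow>
      disjoint_family_on (\<lambda>(u, v). {u<..<v}) P \<Longrightarrow> (\<Sum>(u, v)\<in>P. v - u) < d2 \<Longrightarrow>
      (\<Sum>(u, v)\<in>P. norm (g v - g u)) < e"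
    using g e unfolding abs_continuous_on_def by meson
  have "(\<Sum>(u, v)\<in>P. norm (H v - H u)) < \<epsilon>"
    if P: "finite P" "\<forall>(u, v)\<in>P. u \<le> v \<and> {u..v} \<subseteq> S"
      "disjoint_family_on (\<lambda>(u, v). {u<..<v}) P" "(\<Sum>(u, v)\<in>P. v - u) < min d1 d2" for P
  proof -
    have "(\<Sum>(u, v)\<in>P. norm (H v - H u))
        \<le> (\<Sum>(u, v)\<in>P. m * (norm (f v - f u) + norm (g v - g u)))"
    proof (rule sum_mono, clarify)
      fix u v assume "(u, v) \<in> P"
      with P(2) have "u \<in> S" "v \<in> S" by force+
      then have "norm (H v - H u) \<le> M * (norm (f v - f u) + norm (g v - g u))"
        by (rule dom)
      also have "\<dots> \<le> m * (norm (f v - f u) + norm (g v - g u))"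
        using m by (intro mult_right_mono) auto
      finally show "norm (H v - H u) \<le> m * (norm (f v - f u) + norm (g v - g u))" .
    qed
    also have "\<dots> = m * ((\<Sum>(u, v)\<in>P. norm (f v - f u)) + (\<Sum>(u, v)\<in>P. norm (g v - g u)))"
      by (simp add: sum.distrib sum_distrib_left case_prod_unfold algebra_simps)
    also have "\<dots> < m * (e + e)"
      using P m by (intro mult_strict_left_mono add_strict_mono d1 d2) auto
    also have "\<dots> = \<epsilon>" using m by (simp add: e_def field_simps)
    finally show ?thesis .
  qed
  then show "\<exists>\<delta>>0. \<forall>P :: (real \<times> real) set.
        finite P \<and> (\<forall>(u, v)\<in>P. u \<le> v \<and> {u..v} \<subseteq> S) \<and>
        disjoint_family_on (\<lambda>(u, v). {u<..<v}) P \<and> (\<Sum>(u, v)\<in>P. v - u) < \<delta>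
        \<longrightarrow> (\<Sum>(u, v)\<in>P. norm (H v - H u)) < \<epsilon>"
    using d1(1) d2(1) by (intro exI[of _ "min d1 d2"]) auto
qed

lemma abs_continuous_on_cong:
  assumes "abs_continuous_on S f" "\<And>x. x \<in> S \<Longrightarrow> g x = f x"
  shows "abs_continuous_on S g"
  by (rule abs_continuous_on_dominated[OF assms(1) assms(1), where M = 1]) (simp add: assms(2))

lemma abs_continuous_on_imp_continuous_on:
  fixes f :: "real \<Rightarrow> 'a::real_normed_vector"
  assumes "abs_continuous_on {a..b} f"
  shows "continuous_on {a..b} f"
  unfolding continuous_on_iff
proof (intro ballI allI impI)
  fix x e :: real assume x: "x \<in> {a..b}" and e: "e > 0"
  obtain d where d: "d > 0" "\<And>P. finite P \<Longrightarrow> (\<forall>(u, v)\<in>P. u \<le> v \<and> {u..v} \<subseteq> {a..b}) \<Longrightarrow>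
      disjoint_family_on (\<lambda>(u, v). {u<..<v}) P \<Longrightarrow> (\<Sum>(u, v)\<in>P. v - u) < d \<Longrightarrow>
      (\<Sum>(u, v)\<in>P. norm (f v - f u)) < e"
    using assms e unfolding abs_continuous_on_def by meson
  have "dist (f y) (f x) < e" if "y \<in> {a..b}" "dist y x < d" for y
    using d(2)[of "{(min x y, max x y)}"] x that
    by (auto simp: disjoint_family_on_def dist_norm norm_minus_commute min_def max_def abs_if split: if_splits)
  with d(1) show "\<exists>d>0. \<forall>x'\<in>{a..b}. dist x' x < d \<longrightarrow> dist (f x') (f x) < e" by blast
qed

lemma abs_continuous_on_diff:
  assumes "abs_continuous_on S f" "abs_continuous_on S g"
  shows "abs_continuous_on S (\<lambda>x. f x - g x)"
  using assms
proof (rule abs_continuous_on_dominated[where M = 1])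
  fix u v
  show "norm (f v - g v - (f u - g u)) \<le> 1 * (norm (f v - f u) + norm (g v - g u))"
    using norm_triangle_ineq4[of "f v - f u" "g v - g u"] by (simp add: algebra_simps)
qed

lemma abs_continuous_on_of_real:
  fixes f :: "real \<Rightarrow> real"
  assumes "abs_continuous_on S f"
  shows "abs_continuous_on S (\<lambda>x. of_real (f x) :: 'a::real_normed_algebra_1)"
  using assms assms
  by (rule abs_continuous_on_dominated[where M = 1])
     (simp flip: of_real_diff)

lemma abs_continuous_on_mult:
  fixes f g :: "real \<Rightarrow> 'a::real_normed_algebra"
  assumes f: "abs_continuous_on {a..b} f" and g: "abs_continuous_on {a..b} g"
  shows "abs_continuous_on {a..b} (\<lambda>x. f x * g x)"
proof -
  have "bounded (f ` {a..b})" "bounded (g ` {a..b})"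
    using assms by (auto intro!: compact_imp_bounded compact_continuous_image abs_continuous_on_imp_continuous_on)
  then obtain A B where A: "\<And>x. x \<in> {a..b} \<Longrightarrow> norm (f x) \<le> A" and B: "\<And>x. x \<in> {a..b} \<Longrightarrow> norm (g x) \<le> B"
    unfolding bounded_iff by (metis imageI)
  show ?thesis
  proof (rule abs_continuous_on_dominated[OF f g, where M = "max A B"])
    fix u v assume uv: "u \<in> {a..b}" "v \<in> {a..b}"
    have "f v * g v - f u * g u = (f v - f u) * g v + f u * (g v - g u)" by (simp add: algebra_simps)
    then have "norm (f v * g v - f u * g u) \<le> norm (f v - f u) * norm (g v) + norm (f u) * norm (g v - g u)"
      by (metis norm_triangle_mono norm_mult_ineq)
    also have "\<dots> \<le> norm (f v - f u) * max A B + max A B * norm (g v - g u)"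
      by (intro add_mono mult_mono) (use A B uv in \<open>auto simp: le_max_iff_disj intro: order_trans[OF norm_ge_zero]\<close>)
    finally show "norm (f v * g v - f u * g u) \<le> max A B * (norm (f v - f u) + norm (g v - g u))"
      by (simp add: algebra_simps)
  qed
qed

lemma abs_continuous_on_C1:
  fixes f :: "real \<Rightarrow> 'a::real_normed_vector"
  assumes f: "\<And>x. x \<in> {a..b} \<Longrightarrow> (f has_vector_derivative f' x) (at x within {a..b})"
    and cont: "continuous_on {a..b} f'"
  shows "abs_continuous_on {a..b} f"
proof -
  have "bounded (f' ` {a..b})"
    by (intro compact_imp_bounded compact_continuous_image cont) simp
  then obtain B where B: "\<And>x. x \<in> {a..b} \<Longrightarrow> norm (f' x) \<le> B"
    unfolding bounded_iff by (metis imageI)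
  show ?thesis
  proof (rule abs_continuous_on_dominated[OF abs_continuous_on_ident abs_continuous_on_ident, where M = B])
    fix u v assume uv: "u \<in> {a..b}" "v \<in> {a..b}"
    have "norm (f v - f u) \<le> B * norm (v - u)"
    proof (rule differentiable_bound[of "{a..b}" f "\<lambda>x h. h *\<^sub>R f' x"])
      fix x assume "x \<in> {a..b}"
      then show "(f has_derivative (\<lambda>h. h *\<^sub>R f' x)) (at x within {a..b})"
        using f by (simp add: has_vector_derivative_def)
      show "onorm (\<lambda>h. h *\<^sub>R f' x) \<le> B"
        using B[OF \<open>x \<in> {a..b}\<close>] by (intro onorm_le) (simp add: mult.commute[of B] mult_left_mono)
    qed (use uv in auto)
    also have "\<dots> \<le> B * (norm (v - u) + norm (v - u))"
      using B[OF uv(1)] by (intro mult_left_mono) (auto intro: order_trans[OF norm_ge_zero])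
    finally show "norm (f v - f u) \<le> B * (norm (v - u) + norm (v - u))" .
  qed
qed

text \<open>The increment over \<open>[a, b]\<close> is split along a tagged division. Intervals tagged at points of
  differentiability contribute at most \<open>\<epsilon> (b - a)\<close> in total, by the choice of a fine gauge there.
  The remaining tags lie in a null set; the gauge keeps their intervals inside an open set of
  small measure, so that absolute continuity bounds their contribution by \<open>\<epsilon>\<close>. A gauge argument
  thus replaces the usual Vitali covering.\<close>

lemma abs_continuous_on_zero_derivative_endpoints:
  fixes f :: "real \<Rightarrow> 'a::real_normed_vector"
  assumes ac: "abs_continuous_on {a..b} f" and ab: "a \<le> b"
    and ae: "AE x\<in>{a<..<b} in lebesgue. (f has_vector_derivative 0) (at x)"
  shows "f b = f a"
proof -
  obtain N where N: "N \<in> null_sets lebesgue"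
    and derN: "\<And>x. x \<in> {a<..<b} \<Longrightarrow> x \<notin> N \<Longrightarrow> (f has_vector_derivative 0) (at x)"
    using ae unfolding eventually_ae_filter by auto
  \<comment> \<open>The endpoints join the exceptional set, as no derivative is assumed there.\<close>
  define Z where "Z = N \<union> {a, b}"
  have Z: "Z \<in> null_sets lebesgue"
    unfolding Z_def using N by (intro null_sets.Un) (simp_all add: negligible_iff_null_sets[symmetric])
  have der: "(f has_vector_derivative 0) (at x)" if "x \<in> {a..b}" "x \<notin> Z" for x
    using that by (intro derN) (auto simp: Z_def)
  have bound: "norm (f b - f a) \<le> \<epsilon> * (1 + (b - a))" if \<epsilon>: "\<epsilon> > 0" for \<epsilon>
  proof -
    obtain d where d: "d > 0" "\<And>P. finite P \<Longrightarrow> (\<forall>(u, v)\<in>P. u \<le> v \<and> {u..v} \<subseteq> {a..b}) \<Longrightarrow>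
        disjoint_family_on (\<lambda>(u, v). {u<..<v}) P \<Longrightarrow> (\<Sum>(u, v)\<in>P. v - u) < d \<Longrightarrow>
        (\<Sum>(u, v)\<in>P. norm (f v - f u)) < \<epsilon>"
      using ac \<epsilon> unfolding abs_continuous_on_def by meson
    obtain T where T: "open T" "Z \<subseteq> T" "T - Z \<in> lmeasurable" "emeasure lebesgue (T - Z) < ennreal d"
      using sets_lebesgue_outer_open[OF _ d(1), of Z] Z by blast
    have eT: "emeasure lebesgue T < ennreal d"
      using T Z by (metis emeasure_Diff_null_set borel_open sets_completionI_sets sets_lborel)
    then have fT: "emeasure lebesgue T < top"
      by (rule order_less_trans) simp
    have mT: "measure lebesgue T < d"
      using eT d(1) fT by (simp add: measure_def enn2real_less_iff)
    have "\<exists>\<eta>>0. \<forall>y. \<bar>y - x\<bar> < \<eta> \<longrightarrow> norm (f y - f x) \<le> \<epsilon> * \<bar>y - x\<bar>" if "x \<in> {a..b}" "x \<notin> Z" for x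
      using der[OF that] \<epsilon> unfolding has_vector_derivative_def has_derivative_at_alt by simp
    then obtain \<eta> where \<eta>: "\<And>x. x \<in> {a..b} \<Longrightarrow> x \<notin> Z \<Longrightarrow> \<eta> x > 0"
      "\<And>x y. x \<in> {a..b} \<Longrightarrow> x \<notin> Z \<Longrightarrow> \<bar>y - x\<bar> < \<eta> x \<Longrightarrow> norm (f y - f x) \<le> \<epsilon> * \<bar>y - x\<bar>"
      by metis
    define \<gamma> where "\<gamma> x = (if x \<in> Z then T else if x \<in> {a..b} then ball x (\<eta> x) else UNIV)" for x
    have "gauge \<gamma>"
      using T \<eta>(1) by (auto simp: gauge_def \<gamma>_def)
    then obtain p where p: "p tagged_division_of {a..b}" "\<gamma> fine p"
      by (rule fine_division_exists_real)
    note pD = tagged_division_ofD[OF p(1)]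
    have K: "{Inf K..Sup K} = K" "Inf K \<le> x" "x \<le> Sup K" "K \<subseteq> {a..b}" "K \<subseteq> \<gamma> x" "x \<in> {a..b}"
      if xK: "(x, K) \<in> p" for x K
    proof -
      obtain u v where "K = {u..v}" using pD(4)[OF xK] by auto
      with pD(2)[OF xK] pD(3)[OF xK] show "{Inf K..Sup K} = K" "Inf K \<le> x" "x \<le> Sup K" "K \<subseteq> {a..b}"
        "x \<in> {a..b}" by auto
      show "K \<subseteq> \<gamma> x" using p(2) xK by (rule fineD)
    qed
    define pZ where "pZ = {(x, K) \<in> p. x \<in> Z}"
    define P where "P = (\<lambda>(x, K). (Inf K, Sup K)) ` pZ"
    have fin: "finite p" "finite pZ" using pD(1) by (auto simp: pZ_def intro: finite_subset[of _ p])
    have fP: "finite P" using fin by (simp add: P_def)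
    have KZ: "Inf K \<le> Sup K" "{Inf K..Sup K} \<subseteq> {a..b}" "{Inf K<..<Sup K} \<subseteq> T"
      if "(x, K) \<in> pZ" for x K
    proof -
      have xK: "(x, K) \<in> p" "x \<in> Z" using that by (auto simp: pZ_def)
      note K = K[OF xK(1)]
      show "Inf K \<le> Sup K" using K(2,3) by linarith
      show "{Inf K..Sup K} \<subseteq> {a..b}" using K(1,4) by simp
      have "{Inf K..Sup K} \<subseteq> T" using K(1,5) xK(2) by (simp add: \<gamma>_def)
      moreover have "{Inf K<..<Sup K} \<subseteq> {Inf K..Sup K}" by auto
      ultimately show "{Inf K<..<Sup K} \<subseteq> T" by (rule order_trans[rotated])
    qed
    have P1: "\<forall>(u, v)\<in>P. u \<le> v \<and> {u..v} \<subseteq> {a..b} \<and> {u<..<v} \<subseteq> T"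
    proof
      fix s assume "s \<in> P"
      then obtain x K where "(x, K) \<in> pZ" "s = (Inf K, Sup K)" by (auto simp: P_def)
      with KZ show "case s of (u, v) \<Rightarrow> u \<le> v \<and> {u..v} \<subseteq> {a..b} \<and> {u<..<v} \<subseteq> T" by simp
    qed
    have disj: "{Inf K<..<Sup K} \<inter> {Inf L<..<Sup L} = {}"
      if "(x, K) \<in> p" "(y, L) \<in> p" "(x, K) \<noteq> (y, L)" for x K y L
    proof -
      have "interior {Inf K..Sup K} \<inter> interior {Inf L..Sup L} = {}"
        using pD(5)[OF that] K(1)[OF that(1)] K(1)[OF that(2)] by simp
      then show ?thesis by (simp add: interior_atLeastAtMost_real)
    qed
    have P2: "disjoint_family_on (\<lambda>(u, v). {u<..<v}) P"
      unfolding disjoint_family_on_def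
    proof (intro ballI impI)
      fix s r assume "s \<in> P" "r \<in> P" "s \<noteq> r"
      then obtain x K y L where "(x, K) \<in> p" "(y, L) \<in> p" "s = (Inf K, Sup K)" "r = (Inf L, Sup L)"
        by (auto simp: P_def pZ_def)
      with \<open>s \<noteq> r\<close> disj[of x K y L] show "(case s of (u, v) \<Rightarrow> {u<..<v}) \<inter> (case r of (u, v) \<Rightarrow> {u<..<v}) = {}"
        by auto
    qed
    have "(\<Sum>(u, v)\<in>P. v - u) = (\<Sum>s\<in>P. measure lebesgue (case s of (u, v) \<Rightarrow> {u<..<v}))"
      using P1 by (intro sum.cong) auto
    also have "\<dots> = measure lebesgue (\<Union>s\<in>P. case s of (u, v) \<Rightarrow> {u<..<v})"
      using P1 by (intro measure_finite_Union[symmetric] fP P2) (auto split: prod.splits)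
    also have "\<dots> \<le> measure lebesgue T"
    proof (rule measure_mono_fmeasurable)
      show "(\<Union>s\<in>P. case s of (u, v) \<Rightarrow> {u<..<v}) \<subseteq> T" using P1 by fastforce
      show "(\<Union>s\<in>P. case s of (u, v) \<Rightarrow> {u<..<v}) \<in> sets lebesgue"
        by (intro sets.finite_UN fP) auto
      show "T \<in> lmeasurable" 
        using T(1) fT by (simp add: fmeasurable_def)
    qed
    also note mT
    finally have sumP: "(\<Sum>(u, v)\<in>P. norm (f v - f u)) < \<epsilon>"
      using P1 by (intro d(2) fP P2) auto
    have "(\<Sum>(u, v)\<in>P. norm (f v - f u)) = (\<Sum>(x, K)\<in>pZ. norm (f (Sup K) - f (Inf K)))"
      unfolding P_def
      \<comment> \<open>Different tags can share an interval only if it is a single point, which contributes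
        nothing.\<close>
    proof (subst sum.reindex_nontrivial)
      fix s r assume "s \<in> pZ" "r \<in> pZ" "s \<noteq> r"
        and eq: "(case s of (x, K) \<Rightarrow> (Inf K, Sup K)) = (case r of (x, K) \<Rightarrow> (Inf K, Sup K))"
      then obtain x K y L where sr: "s = (x, K)" "r = (y, L)" "(x, K) \<in> p" "(y, L) \<in> p" "(x, K) \<noteq> (y, L)"
        by (cases s, cases r) (auto simp: pZ_def)
      with eq have "Inf L = Inf K" "Sup L = Sup K" by auto
      with disj[OF sr(3-5)] have "{Inf K<..<Sup K} = {}" by simp
      with K(2,3)[OF sr(3)] have "Inf K = Sup K" by simp
      then show "(case (case s of (x, K) \<Rightarrow> (Inf K, Sup K)) of (u, v) \<Rightarrow> norm (f v - f u)) = 0"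
        using sr by simp
    qed (use fin in \<open>auto simp: case_prod_unfold\<close>)
    with sumP have sumZ: "(\<Sum>(x, K)\<in>pZ. norm (f (Sup K) - f (Inf K))) \<le> \<epsilon>" by simp
    have "(\<Sum>(x, K)\<in>p - pZ. norm (f (Sup K) - f (Inf K))) \<le> (\<Sum>(x, K)\<in>p - pZ. \<epsilon> * (Sup K - Inf K))"
    proof (rule sum_mono, clarify)
      fix x K assume xK: "(x, K) \<in> p" "(x, K) \<notin> pZ"
      then have nZ: "x \<notin> Z" by (simp add: pZ_def)
      note K = K[OF xK(1)]
      have "{Inf K..Sup K} \<subseteq> ball x (\<eta> x)"
        using K(1,5,6) nZ by (simp add: \<gamma>_def)
      moreover have "Sup K \<in> {Inf K..Sup K}" "Inf K \<in> {Inf K..Sup K}" using K(2,3) by auto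
      ultimately have "Sup K \<in> ball x (\<eta> x)" "Inf K \<in> ball x (\<eta> x)" by blast+
      then have "\<bar>Sup K - x\<bar> < \<eta> x" "\<bar>Inf K - x\<bar> < \<eta> x"
        by (simp_all add: dist_real_def abs_minus_commute)
      then have "norm (f (Sup K) - f x) \<le> \<epsilon> * \<bar>Sup K - x\<bar>" "norm (f (Inf K) - f x) \<le> \<epsilon> * \<bar>Inf K - x\<bar>"
        using \<eta>(2) K(6) nZ by blast+
      then have "norm ((f (Sup K) - f x) - (f (Inf K) - f x)) \<le> \<epsilon> * \<bar>Sup K - x\<bar> + \<epsilon> * \<bar>Inf K - x\<bar>"
        using norm_triangle_ineq4[of "f (Sup K) - f x" "f (Inf K) - f x"] by linarith
      also have "\<dots> = \<epsilon> * (Sup K - Inf K)" using K(2,3) by (simp add: algebra_simps)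
      finally show "norm (f (Sup K) - f (Inf K)) \<le> \<epsilon> * (Sup K - Inf K)" by simp
    qed
    also have "\<dots> \<le> (\<Sum>(x, K)\<in>p. \<epsilon> * (Sup K - Inf K))"
    proof (rule sum_mono2)
      fix s assume "s \<in> p - (p - pZ)"
      then obtain x K where s: "s = (x, K)" "(x, K) \<in> p" by (cases s) auto
      with K(2,3)[OF s(2)] \<epsilon> show "0 \<le> (case s of (x, K) \<Rightarrow> \<epsilon> * (Sup K - Inf K))" by simp
    qed (use fin in auto)
    also have "\<dots> = \<epsilon> * (b - a)"
      using additive_tagged_division_1[OF ab p(1), of "\<lambda>x. x"]
      by (simp add: sum_distrib_left[symmetric] case_prod_unfold)
    finally have sumN: "(\<Sum>(x, K)\<in>p - pZ. norm (f (Sup K) - f (Inf K))) \<le> \<epsilon> * (b - a)" .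
    have "norm (f b - f a) = norm (\<Sum>(x, K)\<in>p. f (Sup K) - f (Inf K))"
      by (simp add: additive_tagged_division_1[OF ab p(1)])
    also have "\<dots> \<le> (\<Sum>(x, K)\<in>p. norm (f (Sup K) - f (Inf K)))"
      using norm_sum[of "\<lambda>(x, K). f (Sup K) - f (Inf K)" p] by (simp add: case_prod_unfold)
    also have "\<dots> = (\<Sum>(x, K)\<in>p - pZ. norm (f (Sup K) - f (Inf K))) + (\<Sum>(x, K)\<in>pZ. norm (f (Sup K) - f (Inf K)))"
      by (rule sum.subset_diff) (auto simp: pZ_def fin)
    also have "\<dots> \<le> \<epsilon> * (1 + (b - a))" using sumN sumZ by (simp add: algebra_simps)
    finally show ?thesis .
  qed
  have "norm (f b - f a) \<le> 0"
  proof (rule field_le_epsilon)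
    fix e :: real assume "e > 0"
    with bound[of "e / (1 + (b - a))"] ab show "norm (f b - f a) \<le> 0 + e" by simp
  qed
  then show ?thesis by simp
qed

lemma abs_continuous_on_zero_derivative_constant:
  fixes f :: "real \<Rightarrow> 'a::real_normed_vector"
  assumes ac: "abs_continuous_on {a..b} f"
    and ae: "AE x\<in>{a<..<b} in lebesgue. (f has_vector_derivative 0) (at x)"
    and xy: "x \<in> {a..b}" "y \<in> {a..b}"
  shows "f x = f y"
proof -
  have "f c = f a" if "c \<in> {a..b}" for c
    using that ae
    by (intro abs_continuous_on_zero_derivative_endpoints abs_continuous_on_subset[OF ac]) 
       (auto elim!: eventually_mono)
  with xy show ?thesis by metis
qed

section \<open>Wronskians and solution spaces\<close>

lemma has_vector_derivative_D_on:
  "f differentiable (at x within S) \<Longrightarrow> (f has_vector_derivative D_on S f x) (at x within S)"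
  unfolding D_on_def by (simp add: vector_derivative_works)

lemma D_on_eqI:
  "(f has_vector_derivative d) (at x within {a..b}) \<Longrightarrow> a < b \<Longrightarrow> x \<in> {a..b} \<Longrightarrow> D_on {a..b} f x = d"
  unfolding D_on_def using vector_derivative_within_cbox[of a b x f d] by simp

text \<open>Absolute continuity of the derivative makes it continuous, so the function is \<open>C\<^sup>1\<close>. This is
  how solutions themselves, and not only their derivatives, become admissible factors in the
  product rule for absolutely continuous functions.\<close>

lemma abs_continuous_on_if_D_on:
  assumes "\<forall>x\<in>{a..b}. f differentiable (at x within {a..b})"
    and "abs_continuous_on {a..b} (D_on {a..b} f)"
  shows "abs_continuous_on {a..b} f"
  by (rule abs_continuous_on_C1[of a b f "D_on {a..b} f"])
     (use assms in \<open>auto intro: has_vector_derivative_D_on abs_continuous_on_imp_continuous_on\<close>)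

definition wronskian :: "real set \<Rightarrow> (real \<Rightarrow> complex) \<Rightarrow> (real \<Rightarrow> complex) \<Rightarrow> real \<Rightarrow> complex" where
  "wronskian S u v x = u x * D_on S v x - D_on S u x * v x"

text \<open>The derivative of the Wronskian of two solutions with the same spectral parameter vanishes
  wherever the two equations hold. That is only almost everywhere, which is why the absolute
  continuity of the Wronskian is needed.\<close>

lemma wronskian_constant:
  assumes u: "sl_solution a b q lam u" and v: "sl_solution a b q lam v"
    and xy: "x \<in> {a..b}" "y \<in> {a..b}"
  shows "wronskian {a..b} u v x = wronskian {a..b} u v y"
proof (rule abs_continuous_on_zero_derivative_constant[OF _ _ xy])
  show "abs_continuous_on {a..b} (wronskian {a..b} u v)"
  proof -
    have "abs_continuous_on {a..b} (D_on {a..b} u)" "abs_continuous_on {a..b} u"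
      "abs_continuous_on {a..b} (D_on {a..b} v)" "abs_continuous_on {a..b} v"
      using u v unfolding sl_solution_def
      by (auto intro!: abs_continuous_on_if_D_on[of a b u] abs_continuous_on_if_D_on[of a b v])
    then show ?thesis
      unfolding wronskian_def[abs_def] by (intro abs_continuous_on_diff abs_continuous_on_mult)
  qed
  have "AE x\<in>{a<..<b} in lebesgue. 
        \<exists>y2. (D_on {a..b} u has_vector_derivative y2) (at x) \<and> - y2 + complex_of_real (q x) * u x = lam * u x"
    and "AE x\<in>{a<..<b} in lebesgue. 
        \<exists>y2. (D_on {a..b} v has_vector_derivative y2) (at x) \<and> - y2 + complex_of_real (q x) * v x = lam * v x"
    using u v unfolding sl_solution_def by auto
  then show "AE x\<in>{a<..<b} in lebesgue. (wronskian {a..b} u v has_vector_derivative 0) (at x)"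
  proof eventually_elim
    case (elim x)
    show ?case
    proof
      assume x: "x \<in> {a<..<b}"
      then obtain u2 v2
        where u2: "(D_on {a..b} u has_vector_derivative u2) (at x)" "- u2 + complex_of_real (q x) * u x = lam * u x"
          and v2: "(D_on {a..b} v has_vector_derivative v2) (at x)" "- v2 + complex_of_real (q x) * v x = lam * v x"
        using elim by auto
      have "u differentiable (at x within {a..b})" "v differentiable (at x within {a..b})"
        using u v x unfolding sl_solution_def by auto
      then have u1: "(u has_vector_derivative D_on {a..b} u x) (at x)"
        and v1: "(v has_vector_derivative D_on {a..b} v x) (at x)"
        using x at_within_Icc_at[of a x b] by (metis greaterThanLessThan_iff has_vector_derivative_D_on)+
      \<comment> \<open>Both second derivatives are the same multiple of the function, so they cancel in the
        derivative of the Wronskian.\<close>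
      have uv2: "u2 = (of_real (q x) - lam) * u x" "v2 = (of_real (q x) - lam) * v x"
        using u2(2) v2(2) by (simp_all add: algebra_simps)
      have "u x * v2 + D_on {a..b} u x * D_on {a..b} v x
          - (D_on {a..b} u x * D_on {a..b} v x + u2 * v x) = 0"
        unfolding uv2 by (simp add: algebra_simps)
      moreover have "(wronskian {a..b} u v has_vector_derivative
          u x * v2 + D_on {a..b} u x * D_on {a..b} v x
          - (D_on {a..b} u x * D_on {a..b} v x + u2 * v x)) (at x)"
        unfolding wronskian_def[abs_def]
        by (intro has_vector_derivative_diff has_vector_derivative_mult u1 u2(1) v1 v2(1))
      ultimately show "(wronskian {a..b} u v has_vector_derivative 0) (at x)" by simp
    qed
  qed
qed

text \<open>Solving the \<open>2 \<times> 2\<close> system for \<open>y\<close> by Cramer's rule. This plays the part of the uniqueness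
  theorem for initial value problems, but follows from the constancy of three Wronskians alone,
  without an integral estimate on the potential. The points \<open>c\<close>, \<open>d\<close>, \<open>e\<close> at which the Wronskians
  are evaluated may differ, so that boundary data at either end can be used.\<close>

lemma sl_solution_decomposition:
  assumes "sl_solution a b q lam u" "sl_solution a b q lam v" "sl_solution a b q lam y"
    and "wronskian {a..b} u v c = 1"
    and "c \<in> {a..b}" "d \<in> {a..b}" "e \<in> {a..b}" "x \<in> {a..b}"
  shows "y x = wronskian {a..b} y v d * u x + wronskian {a..b} u y e * v x"
proof -
  have "wronskian {a..b} y v d = wronskian {a..b} y v x" "wronskian {a..b} u y e = wronskian {a..b} u y x"
    "wronskian {a..b} u v x = 1"
    using wronskian_constant assms by metis+
  moreover have "wronskian {a..b} y v x * u x + wronskian {a..b} u y x * v x = wronskian {a..b} u v x * y x"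
    by (simp add: wronskian_def algebra_simps)
  ultimately show ?thesis by simp
qed

section \<open>The positive solution at spectral parameter zero\<close>

text \<open>If \<open>f = \<surd>F\<close>, then \<open>f' = F' / (2\<surd>F)\<close> is the product of an absolutely continuous function with
  a \<open>C\<^sup>1\<close> function, because \<open>F\<close> is positive on the closed interval. Hence \<open>f\<close> is regular enough
  to be a solution of \<open>- y'' + (f''/f) y = 0\<close>, an equation that it satisfies trivially wherever
  \<open>f''\<close> exists.\<close>

lemma sl_solution_of_H2_sqrt:
  assumes F: "H2 a b F" and pos: "\<forall>x\<in>{a..b}. F x > 0"
    and f_eq: "f = (\<lambda>x. sqrt (F x))" and ab: "a < b"
  shows "sl_solution a b (\<lambda>x. D_on {a..b} (D_on {a..b} f) x / f x) 0 (\<lambda>x. of_real (f x))"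
    and "\<And>x. x \<in> {a..b} \<Longrightarrow> D_on {a..b} (\<lambda>x. complex_of_real (f x)) x = of_real (D_on {a..b} f x)"
proof -
  define I where "I = {a..b}"
  define F' where "F' = D_on I F"
  define w where "w x = inverse (2 * f x)" for x
  have f_pos: "f x > 0" if "x \<in> I" for x using pos that by (simp add: f_eq I_def)
  have F1: "(F has_vector_derivative F' x) (at x within I)" if "x \<in> I" for x
    using F that unfolding H2_def F'_def I_def by (auto intro: has_vector_derivative_D_on)
  have F'_ac: "abs_continuous_on I F'"
    using F unfolding H2_def F'_def I_def by auto
  have f1: "(f has_vector_derivative F' x * w x) (at x within I)" if "x \<in> I" for x
  proof -
    have "F x > 0" using pos that by (simp add: I_def)
    moreover have "(F has_real_derivative F' x) (at x within I)"
      using F1[OF that] by (simp add: has_real_derivative_iff_has_vector_derivative)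
    ultimately have "(f has_real_derivative F' x * w x) (at x within I)"
      unfolding f_eq w_def by (auto intro!: derivative_eq_intros simp: field_simps)
    then show ?thesis by (simp add: has_real_derivative_iff_has_vector_derivative)
  qed
  have w1: "(w has_vector_derivative - (F' x * w x) * 2 * (w x * w x)) (at x within I)" if "x \<in> I" for x
  proof -
    have "(f has_real_derivative F' x * w x) (at x within I)"
      using f1[OF that] by (simp add: has_real_derivative_iff_has_vector_derivative)
    then have "((\<lambda>x. inverse (2 * f x)) has_real_derivative
        - (inverse (2 * f x) * (2 * (F' x * w x)) * inverse (2 * f x))) (at x within I)"
      using f_pos[OF that] by (intro DERIV_inverse' DERIV_cmult) auto
    then have "(w has_real_derivative - (F' x * w x) * 2 * (w x * w x)) (at x within I)"
      unfolding w_def by (simp add: mult_ac)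
    then show ?thesis by (simp add: has_real_derivative_iff_has_vector_derivative)
  qed
  have w_cont: "continuous_on I w"
    unfolding continuous_on_eq_continuous_within
    by (intro ballI has_vector_derivative_continuous[OF w1])
  have F'_cont: "continuous_on I F'"
    using F'_ac unfolding I_def by (rule abs_continuous_on_imp_continuous_on)
  have w_ac: "abs_continuous_on I w"
    unfolding I_def
  proof (rule abs_continuous_on_C1)
    show "(w has_vector_derivative - (F' x * w x) * 2 * (w x * w x)) (at x within {a..b})"
      if "x \<in> {a..b}" for x
      using w1 that unfolding I_def by blast
    show "continuous_on {a..b} (\<lambda>x. - (F' x * w x) * 2 * (w x * w x))"
      using F'_cont w_cont unfolding I_def
      by (intro continuous_on_mult continuous_on_minus continuous_on_const)
  qed
  have Df: "D_on I f x = F' x * w x" if "x \<in> I" for x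
    using f1[OF that] ab that unfolding I_def by (intro D_on_eqI)
  have Df_ac: "abs_continuous_on I (D_on I f)"
  proof (rule abs_continuous_on_cong)
    show "abs_continuous_on I (\<lambda>x. F' x * w x)"
      using F'_ac w_ac unfolding I_def by (rule abs_continuous_on_mult)
  qed (rule Df)
  let ?y = "\<lambda>x. complex_of_real (f x)"
  have y1: "(?y has_vector_derivative of_real (F' x * w x)) (at x within I)" if "x \<in> I" for x
    using f1[OF that] by (rule bounded_linear.has_vector_derivative[OF bounded_linear_of_real])
  have Dy: "D_on I ?y x = of_real (D_on I f x)" if "x \<in> I" for x
    unfolding Df[OF that] using y1[OF that] ab that unfolding I_def by (rule D_on_eqI)
  show "\<And>x. x \<in> {a..b} \<Longrightarrow> D_on {a..b} ?y x = of_real (D_on {a..b} f x)"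
    using Dy by (simp add: I_def)
  have y_ac: "abs_continuous_on I (D_on I ?y)"
    using abs_continuous_on_of_real[OF Df_ac] Dy by (rule abs_continuous_on_cong)
  obtain g where "AE x\<in>{a<..<b} in lebesgue. (F' has_vector_derivative g x) (at x)"
    using F unfolding H2_def F'_def I_def by auto
  then have y_ae: "AE x\<in>{a<..<b} in lebesgue.
      \<exists>y2. (D_on I ?y has_vector_derivative y2) (at x) \<and>
           - y2 + complex_of_real (D_on I (D_on I f) x / f x) * ?y x = 0 * ?y x"
  proof eventually_elim
    case (elim x)
    show ?case
    proof
      assume x: "x \<in> {a<..<b}"
      then have F2: "(F' has_vector_derivative g x) (at x)" using elim by blast
      have inner: "y \<in> I" if "y \<in> {a<..<b}" for y using that by (auto simp: I_def)
      then have xI: "x \<in> I" using x by blast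
      have at: "at x within I = at x"
        using x unfolding I_def by (intro at_within_Icc_at) auto
      have "\<exists>d. ((\<lambda>x. F' x * w x) has_vector_derivative d) (at x)"
        using has_vector_derivative_mult[OF F2 w1[OF xI, unfolded at]] by blast
      then obtain d where d: "((\<lambda>x. F' x * w x) has_vector_derivative d) (at x)" ..
      have f2: "(D_on I f has_vector_derivative d) (at x)"
        using d open_greaterThanLessThan x
        by (rule has_vector_derivative_transform_within_open) (simp add: inner Df)
      have "((\<lambda>x. complex_of_real (D_on I f x)) has_vector_derivative of_real d) (at x)"
        using f2 by (rule bounded_linear.has_vector_derivative[OF bounded_linear_of_real])
      then have y2: "(D_on I ?y has_vector_derivative of_real d) (at x)"
        using open_greaterThanLessThan x
        by (rule has_vector_derivative_transform_within_open) (simp add: inner Dy)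
      have "D_on I (D_on I f) x = d"
        using f2 ab xI at unfolding I_def by (intro D_on_eqI) auto
      with y2 f_pos[OF xI] show "\<exists>y2. (D_on I ?y has_vector_derivative y2) (at x) \<and>
           - y2 + complex_of_real (D_on I (D_on I f) x / f x) * ?y x = 0 * ?y x"
        by (intro exI[of _ "of_real d"]) simp
    qed
  qed
  show "sl_solution a b (\<lambda>x. D_on {a..b} (D_on {a..b} f) x / f x) 0 ?y"
    unfolding sl_solution_def
  proof (intro conjI ballI)
    show "?y differentiable (at x within {a..b})" if "x \<in> {a..b}" for x
      using differentiableI_vector[OF y1] that unfolding I_def by blast
  qed (use y_ac y_ae in \<open>simp_all only: I_def\<close>)
qed

section \<open>Proportional solutions at the eigenvalues\<close>

theorem mainTheorem3:
  fixes F a q :: "real \<Rightarrow> real" and h :: real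
    and \<mu> :: "nat \<Rightarrow> complex"
    and \<phi> S T :: "complex \<Rightarrow> real \<Rightarrow> complex"
    and g t :: "nat \<Rightarrow> real \<Rightarrow> complex"
  assumes F_H2: "H2 0 pi F"
    and F_pos: "\<forall>x\<in>{0..pi}. F x > 0"
    and a_eq: "a = (\<lambda>x. sqrt (F x))"
    and q_eq: "q = (\<lambda>x. D_on {0..pi} (D_on {0..pi} a) x / a x)"
    and h_eq: "h = D_on {0..pi} a 0 / a 0"
    and spectrum: "range (\<lambda>k. (\<mu> k)\<^sup>2) = sl_spectrum q h"
    and phi: "\<forall>\<rho>. sl_solution 0 pi q (\<rho>\<^sup>2) (\<phi> \<rho>) \<and>
                   \<phi> \<rho> 0 = 1 \<and> D_on {0..pi} (\<phi> \<rho>) 0 = complex_of_real h"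
    and S: "\<forall>\<rho>. sl_solution 0 pi q (\<rho>\<^sup>2) (S \<rho>) \<and>
                 S \<rho> 0 = 0 \<and> D_on {0..pi} (S \<rho>) 0 = 1"
    and T: "\<forall>\<rho>. sl_solution 0 pi q (\<rho>\<^sup>2) (T \<rho>) \<and>
                 T \<rho> pi = 0 \<and> D_on {0..pi} (T \<rho>) pi = 1"
    and g: "phi_coefficients \<phi> g"
    and t: "T_coefficients T t"
  shows "\<exists>\<beta> :: nat \<Rightarrow> complex. \<forall>k.
           \<beta> k \<noteq> 0 \<and>
           (\<forall>x\<in>{0..pi}. T (\<mu> k) x = \<beta> k * \<phi> (\<mu> k) x) \<and>
           \<beta> k = - S (\<mu> k) pi \<and>
           (\<forall>x\<in>{0..pi}.
              (\<Sum>n. (- 1) ^ n * g n x * sph_bessel_j (2 * n) (\<mu> k * of_real x))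
              - 1 / (\<beta> k * \<mu> k) *
                (\<Sum>n. (- 1) ^ n * t n x * sph_bessel_j (2 * n + 1) (\<mu> k * of_real (x - pi)))
              = - cos (\<mu> k * of_real x) + sin (\<mu> k * of_real (x - pi)) / (\<beta> k * \<mu> k))"
proof (intro exI[of _ "\<lambda>k. - S (\<mu> k) pi"] allI)
  fix k
  let ?W = "wronskian {0..pi}" and ?m = "\<mu> k"
  define \<beta> where "\<beta> = - S ?m pi"
  have ends: "0 \<in> {0..pi}" "pi \<in> {0..pi}" by auto
  have phi_sol: "sl_solution 0 pi q (\<rho>\<^sup>2) (\<phi> \<rho>)" and S_sol: "sl_solution 0 pi q (\<rho>\<^sup>2) (S \<rho>)"
    and T_sol: "sl_solution 0 pi q (\<rho>\<^sup>2) (T \<rho>)" for \<rho>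
    using phi S T by auto
  have W0: "?W (\<phi> \<rho>) (S \<rho>) 0 = 1" for \<rho>
    using phi S by (simp add: wronskian_def)
  \<comment> \<open>The left boundary condition makes the Wronskian with \<open>\<phi>\<close> vanish, leaving a multiple of \<open>\<phi>\<close>.\<close>
  have eigen: "y x = ?W y (S \<rho>) 0 * \<phi> \<rho> x"
    if "sl_solution 0 pi q (\<rho>\<^sup>2) y" "D_on {0..pi} y 0 = of_real h * y 0" "x \<in> {0..pi}" for \<rho> y x
  proof -
    have "?W (\<phi> \<rho>) y 0 = 0"
      using phi that(2) by (simp add: wronskian_def)
    then show ?thesis
      using sl_solution_decomposition[OF phi_sol S_sol that(1) W0 ends(1,1,1) that(3)] by simp
  qed
  have "?m\<^sup>2 \<in> sl_spectrum q h"
    using spectrum by blast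
  then obtain y where y: "sl_solution 0 pi q (?m\<^sup>2) y" "D_on {0..pi} y 0 = of_real h * y 0"
      "y pi = 0" "\<exists>x\<in>{0..pi}. y x \<noteq> 0"
    unfolding sl_spectrum_def by auto
  have phi_pi: "\<phi> ?m pi = 0"
    using eigen[OF y(1,2)] y(3,4) ends by force
  have "?W (\<phi> ?m) (S ?m) pi = 1"
    using W0 wronskian_constant[OF phi_sol S_sol ends] by metis
  then have \<beta>_nz: "\<beta> \<noteq> 0"
    using phi_pi by (auto simp: wronskian_def \<beta>_def)
  \<comment> \<open>Read off both coefficients at \<open>\<pi>\<close>, where \<open>\<phi>\<close> and \<open>T\<close> both vanish.\<close>
  have T_eq: "T ?m x = \<beta> * \<phi> ?m x" if "x \<in> {0..pi}" for x
  proof -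
    have "?W (\<phi> ?m) (T ?m) pi = 0" "?W (T ?m) (S ?m) pi = \<beta>"
      using phi_pi T by (simp_all add: wronskian_def \<beta>_def)
    then show ?thesis
      using sl_solution_decomposition[OF phi_sol S_sol T_sol W0 ends(1,2,2) that] by simp
  qed
  have \<mu>_nz: "?m \<noteq> 0"
  proof
    assume m0: "?m = 0"
    \<comment> \<open>\<open>a\<close> satisfies the left boundary condition, so it is a multiple of \<open>\<phi>\<close> at \<open>\<rho> = 0\<close>; but \<open>\<phi>\<close>
      would vanish at \<open>\<pi>\<close>, where \<open>a\<close> is positive.\<close>
    have a_pos: "a x > 0" if "x \<in> {0..pi}" for x
      using F_pos that by (simp add: a_eq)
    note a_sol = sl_solution_of_H2_sqrt[OF F_H2 F_pos a_eq pi_gt_zero, folded q_eq]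
    have "D_on {0..pi} (\<lambda>x. complex_of_real (a x)) 0 = of_real h * of_real (a 0)"
      using a_sol(2)[OF ends(1)] a_pos[OF ends(1)] by (simp add: h_eq)
    then have "complex_of_real (a pi) = ?W (\<lambda>x. of_real (a x)) (S 0) 0 * \<phi> 0 pi"
      using a_sol(1) ends by (intro eigen) auto
    with phi_pi m0 a_pos[OF ends(2)] show False by simp
  qed
  have lin: "(\<Sum>n. phi_term g ?m x n) - 1 / (\<beta> * ?m) * (\<Sum>n. T_term t ?m x n)
      = - cos (?m * of_real x) + sin (?m * of_real (x - pi)) / (\<beta> * ?m)" if "x \<in> {0..pi}" for x
  proof -
    define c sn P Q where "c = cos (?m * of_real x)" and "sn = sin (?m * of_real (x - pi))"
      and "P = (\<Sum>n. phi_term g ?m x n)" and "Q = (\<Sum>n. T_term t ?m x n)"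
    note defs = this
    have "\<phi> ?m x = c + P"
      using g that unfolding phi_coefficients_def defs by blast
    moreover have "T ?m x = sn / ?m + 1 / ?m * Q"
      using t that \<mu>_nz unfolding T_coefficients_def defs by blast
    ultimately have "\<beta> * (c + P) = sn / ?m + 1 / ?m * Q"
      using T_eq[OF that] by simp
    then have "P - 1 / (\<beta> * ?m) * Q = - c + sn / (\<beta> * ?m)"
      using \<beta>_nz \<mu>_nz by (simp add: field_simps)
    then show ?thesis by (simp only: defs)
  qed
  show "- S ?m pi \<noteq> 0 \<and> (\<forall>x\<in>{0..pi}. T ?m x = - S ?m pi * \<phi> ?m x) \<and> - S ?m pi = - S ?m pi \<and>
      (\<forall>x\<in>{0..pi}.
        (\<Sum>n. (- 1) ^ n * g n x * sph_bessel_j (2 * n) (?m * of_real x))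
        - 1 / (- S ?m pi * ?m) *
          (\<Sum>n. (- 1) ^ n * t n x * sph_bessel_j (2 * n + 1) (?m * of_real (x - pi)))
        = - cos (?m * of_real x) + sin (?m * of_real (x - pi)) / (- S ?m pi * ?m))"
    using \<beta>_nz T_eq lin unfolding \<beta>_def phi_term_def T_term_def by blast
qed

end
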